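(* Let $a<b$ be real numbers, let $n\ge 1$ be an integer, and let $a=x_0<x_1<\cdots<x_n=b$ and $a=y_0<y_1<\cdots<y_{n+1}=b$ be two partitions of $[a,b]$ such that $x_{i-1}\le y_i\le x_i$ for $i=1,2,\ldots,n$. Put $x_{-1}=y_{-1}=a$ and $x_{n+1}=y_{n+2}=b$. If $f:[a,b]\to\mathbb{R}$ is convex on $[a,b]$, then $$\text{(I)}\qquad \sum_{i=1}^{n}(x_i-x_{i-1})f(y_i)\le \sum_{i=0}^{n}(x_{i+1}-x_{i-1}+y_i-y_{i+1})f(x_i)$$ and $$\text{(II)}\qquad \sum_{i=0}^{n}(y_{i+1}-y_i)f(x_i)\le \sum_{i=0}^{n+1}(y_{i+1}-y_{i-1}+x_{i-1}-x_i)f(y_i).$$ If $f$ is strictly convex on $[a,b]$, then inequality (I) is strict whenever $x_{i-1}<y_i<x_i$ for some $i\in\{1,2,\ldots,n\}$, and inequality (II) is strict whenever $y_i<x_i<y_{i+1}$ for some $i\in\{1,2,\ldots,n-1\}$. *)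

theory Defs
  imports "HOL-Analysis.Analysis"
begin

(* Strict counterpart of the library's convex_on: strict inequality for distinct
   points and proper convex combinations. *)
definition strictly_convex_on :: "'a::real_vector set \<Rightarrow> ('a \<Rightarrow> real) \<Rightarrow> bool"
  where "strictly_convex_on S f \<longleftrightarrow> convex S \<and>
    (\<forall>x\<in>S. \<forall>y\<in>S. x \<noteq> y \<longrightarrow> (\<forall>u>0. \<forall>v>0. u + v = 1 \<longrightarrow>
      f (u *\<^sub>R x + v *\<^sub>R y) < u * f x + v * f y))"

end

theory Submission
  imports Defs
begin

text \<open>
  Bounding \<open>f (q i)\<close> by the chord of \<open>f\<close> over \<open>[p (i - 1), p i]\<close>, multiplying by the length of
  that interval and collecting the coefficient of each \<open>f (p i)\<close> gives a general inequality for
  interlacing sequences. Inequality (I) is the case \<open>p i = x i\<close>, \<open>q i = y i\<close>, and (II) is the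
  case \<open>p i = y i\<close>, \<open>q i = x (i - 1)\<close>, with \<open>n + 1\<close> in place of \<open>n\<close>.
\<close>

text \<open>Lets the strict case use the weak chord bound on those intervals where
  \<open>q i\<close> meets an endpoint.\<close>

lemma strictly_convex_on_imp_convex_on:
  assumes "strictly_convex_on S f"
  shows "convex_on S f"
proof (rule convex_onI)
  fix t :: real and x y
  assume t: "0 < t" "t < 1" and xy: "x \<in> S" "y \<in> S"
  show "f ((1 - t) *\<^sub>R x + t *\<^sub>R y) \<le> (1 - t) * f x + t * f y"
  proof (cases "x = y")
    case True
    then show ?thesis
      by (simp add: algebra_simps)
  next
    case False
    with assms t xy show ?thesis
      unfolding strictly_convex_on_def by (intro less_imp_le) simp
  qed
qed (use assms in \<open>simp add: strictly_convex_on_def\<close>)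

text \<open>Clearing the denominator \<open>r - p\<close> keeps the bound valid for
  \<open>p = r\<close>, so degenerate intervals need no separate treatment later.\<close>

lemma convex_on_chord:
  fixes f :: "real \<Rightarrow> real"
  assumes "convex_on S f" and "p \<in> S" and "r \<in> S" and "p \<le> q" and "q \<le> r"
  shows "(r - p) * f q \<le> (r - q) * f p + (q - p) * f r"
proof (cases "p = r")
  case True
  with assms show ?thesis
    by simp
next
  case False
  with assms have pr: "p < r"
    by simp
  define t where "t = (q - p) / (r - p)"
  have t: "0 \<le> t" "t \<le> 1" and rt: "(r - p) * t = q - p"
    using assms pr by (auto simp: t_def)
  have "q = (1 - t) *\<^sub>R p + t *\<^sub>R r"
    using rt by (simp add: algebra_simps)
  then have "f q \<le> (1 - t) * f p + t * f r"
    using convex_onD[OF assms(1) t assms(2,3)] by simp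
  then have "(r - p) * f q \<le> (r - p) * ((1 - t) * f p + t * f r)"
    using pr by (intro mult_left_mono) auto
  \<comment> \<open>The product \<open>(r - p) * t\<close> is kept intact so that \<open>rt\<close>
    can replace it by \<open>q - p\<close>.\<close>
  also have "\<dots> = (r - p - (r - p) * t) * f p + (r - p) * t * f r"
    by (simp add: algebra_simps)
  finally show ?thesis
    by (simp add: rt)
qed

lemma strictly_convex_on_chord:
  fixes f :: "real \<Rightarrow> real"
  assumes "strictly_convex_on S f" and "p \<in> S" and "r \<in> S" and "p < q" and "q < r"
  shows "(r - p) * f q < (r - q) * f p + (q - p) * f r"
proof -
  define t where "t = (q - p) / (r - p)"
  have t: "0 < t" "0 < 1 - t" and rt: "(r - p) * t = q - p"
    using assms by (auto simp: t_def)
  have "q = (1 - t) *\<^sub>R p + t *\<^sub>R r"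
    using rt by (simp add: algebra_simps)
  moreover have "p \<noteq> r" and "1 - t + t = 1"
    using assms by auto
  ultimately have "f q < (1 - t) * f p + t * f r"
    using assms(1-3) t unfolding strictly_convex_on_def by blast
  then have "(r - p) * f q < (r - p) * ((1 - t) * f p + t * f r)"
    using assms by (intro mult_strict_left_mono) auto
  also have "\<dots> = (r - p - (r - p) * t) * f p + (r - p) * t * f r"
    by (simp add: algebra_simps)
  finally show ?thesis
    by (simp add: rt)
qed

lemma sum_int_shift:
  fixes g :: "int \<Rightarrow> 'a::comm_monoid_add"
  shows "(\<Sum>i=k..m. g (i + c)) = (\<Sum>i=k+c..m+c. g i)"
  by (rule sum.reindex_bij_witness[of _ "\<lambda>i. i - c" "\<lambda>i. i + c"]) auto

text \<open>Each inner \<open>g i\<close> collects \<open>q i - p (i - 1)\<close> from the interval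
  ending at \<open>p i\<close> and \<open>p (i + 1) - q (i + 1)\<close> from the one starting there.
  At \<open>i = 0\<close> and \<open>i = m\<close> one of these is missing; the conventions for
  \<open>q 0\<close> and \<open>q (m + 1)\<close> make the missing coefficient zero, so one formula
  serves all indices.\<close>

lemma sum_chords_eq:
  fixes p q :: "int \<Rightarrow> real" and g :: "int \<Rightarrow> real"
  assumes "0 \<le> m" and "q 0 = p (-1)" and "q (m + 1) = p (m + 1)"
  shows "(\<Sum>i=1..m. (p i - q i) * g (i - 1) + (q i - p (i - 1)) * g i)
    = (\<Sum>i=0..m. (p (i + 1) - p (i - 1) + q i - q (i + 1)) * g i)"
proof -
  have "(\<Sum>i=1..m. (p i - q i) * g (i - 1)) = (\<Sum>i=0..m-1. (p (i + 1) - q (i + 1)) * g i)"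
    using sum_int_shift[of "\<lambda>i. (p i - q i) * g (i - 1)" 1 0 "m - 1"] by simp
  also have "\<dots> = (\<Sum>i=0..m. (p (i + 1) - q (i + 1)) * g i)"
  proof (rule sum.mono_neutral_left)
    show "\<forall>i\<in>{0..m} - {0..m-1}. (p (i + 1) - q (i + 1)) * g i = 0"
    proof
      fix i assume "i \<in> {0..m} - {0..m-1}"
      then have "i = m"
        by auto
      then show "(p (i + 1) - q (i + 1)) * g i = 0"
        using assms(3) by simp
    qed
  qed auto
  finally have left: "(\<Sum>i=1..m. (p i - q i) * g (i - 1))
    = (\<Sum>i=0..m. (p (i + 1) - q (i + 1)) * g i)" .
  have right: "(\<Sum>i=1..m. (q i - p (i - 1)) * g i) = (\<Sum>i=0..m. (q i - p (i - 1)) * g i)"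
  proof (rule sum.mono_neutral_left)
    show "\<forall>i\<in>{0..m} - {1..m}. (q i - p (i - 1)) * g i = 0"
    proof
      fix i assume "i \<in> {0..m} - {1..m}"
      then have "i = 0"
        by auto
      then show "(q i - p (i - 1)) * g i = 0"
        using assms(2) by simp
    qed
  qed auto
  show ?thesis
    unfolding sum.distrib left right
    unfolding sum.distrib[symmetric]
    by (rule sum.cong) (auto simp: algebra_simps)
qed

lemma int_steps_mono:
  fixes p :: "int \<Rightarrow> 'a::preorder"
  assumes "\<forall>i\<in>{k+1..m}. p (i - 1) \<le> p i" and "k \<le> i" and "i \<le> j" and "j \<le> m"
  shows "p i \<le> p j"
  using assms(3,4)
proof (induction j rule: int_ge_induct)
  case (step j)
  have "p j \<le> p (j + 1)"
    using assms(1,2) step by (auto dest: bspec[of _ _ "j + 1"])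
  with step show ?case
    by (auto intro: order_trans)
qed simp

context
  fixes p q :: "int \<Rightarrow> real" and m :: int and f :: "real \<Rightarrow> real"
  assumes m: "0 \<le> m"
    and interlace: "\<forall>i\<in>{1..m}. p (i - 1) \<le> q i \<and> q i \<le> p i"
    and ends: "q 0 = p (-1)" "q (m + 1) = p (m + 1)"
begin

text \<open>Chaining \<open>p (i - 1) \<le> q i \<le> p i\<close> makes \<open>p\<close> monotone,
  which puts the chord endpoints into the set where \<open>f\<close> is convex.\<close>

lemma interlacing_mem:
  assumes "0 \<le> i" and "i \<le> m"
  shows "p i \<in> {p 0..p m}"
proof -
  have "\<forall>i\<in>{0+1..m}. p (i - 1) \<le> p i"
    using interlace by force
  from int_steps_mono[OF this] show ?thesis
    using assms by simp
qed

lemma interlacing_chord: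
  assumes "convex_on {p 0..p m} f" and "i \<in> {1..m}"
  shows "(p i - p (i - 1)) * f (q i)
    \<le> (p i - q i) * f (p (i - 1)) + (q i - p (i - 1)) * f (p i)"
  using assms interlace by (intro convex_on_chord[OF assms(1)] interlacing_mem) auto

lemma convex_on_interlacing_sum_le:
  assumes "convex_on {p 0..p m} f"
  shows "(\<Sum>i=1..m. (p i - p (i - 1)) * f (q i))
    \<le> (\<Sum>i=0..m. (p (i + 1) - p (i - 1) + q i - q (i + 1)) * f (p i))"
  unfolding sum_chords_eq[OF m ends, of "\<lambda>i. f (p i)", symmetric]
  by (rule sum_mono) (rule interlacing_chord[OF assms])

text \<open>In a finite sum of weak inequalities a single strict one suffices, and the chord with
  \<open>q i\<close> in its interior supplies it.\<close>

lemma strictly_convex_on_interlacing_sum_less: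
  assumes f: "strictly_convex_on {p 0..p m} f"
    and strict: "\<exists>i\<in>{1..m}. p (i - 1) < q i \<and> q i < p i"
  shows "(\<Sum>i=1..m. (p i - p (i - 1)) * f (q i))
    < (\<Sum>i=0..m. (p (i + 1) - p (i - 1) + q i - q (i + 1)) * f (p i))"
  unfolding sum_chords_eq[OF m ends, of "\<lambda>i. f (p i)", symmetric]
proof (rule sum_strict_mono_ex1)
  show "\<forall>i\<in>{1..m}. (p i - p (i - 1)) * f (q i)
    \<le> (p i - q i) * f (p (i - 1)) + (q i - p (i - 1)) * f (p i)"
    using interlacing_chord[OF strictly_convex_on_imp_convex_on[OF f]] by blast
  show "\<exists>i\<in>{1..m}. (p i - p (i - 1)) * f (q i)
    < (p i - q i) * f (p (i - 1)) + (q i - p (i - 1)) * f (p i)"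
  proof -
    from strict obtain i where i: "i \<in> {1..m}" "p (i - 1) < q i" "q i < p i"
      by blast
    then have "(p i - p (i - 1)) * f (q i)
        < (p i - q i) * f (p (i - 1)) + (q i - p (i - 1)) * f (p i)"
      by (intro strictly_convex_on_chord[OF f] interlacing_mem) auto
    with i(1) show ?thesis
      by blast
  qed
qed simp

end

theorem theorem2p1:
  fixes a b :: real and n :: int and x y :: "int \<Rightarrow> real" and f :: "real \<Rightarrow> real"
  assumes "a < b" and "n \<ge> 1"
    and "x 0 = a" and "x n = b" and "\<forall>i\<in>{1..n}. x (i - 1) < x i"
    and "y 0 = a" and "y (n + 1) = b" and "\<forall>i\<in>{1..n+1}. y (i - 1) < y i"
    and "\<forall>i\<in>{1..n}. x (i - 1) \<le> y i \<and> y i \<le> x i"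
    and "x (-1) = a" and "y (-1) = a" and "x (n + 1) = b" and "y (n + 2) = b"
  shows "(convex_on {a..b} f \<longrightarrow>
      (\<Sum>i=1..n. (x i - x (i - 1)) * f (y i))
        \<le> (\<Sum>i=0..n. (x (i + 1) - x (i - 1) + y i - y (i + 1)) * f (x i))
    \<and> (\<Sum>i=0..n. (y (i + 1) - y i) * f (x i))
        \<le> (\<Sum>i=0..n+1. (y (i + 1) - y (i - 1) + x (i - 1) - x i) * f (y i)))
  \<and> (strictly_convex_on {a..b} f \<longrightarrow>
      ((\<exists>i\<in>{1..n}. x (i - 1) < y i \<and> y i < x i) \<longrightarrow>
        (\<Sum>i=1..n. (x i - x (i - 1)) * f (y i))
          < (\<Sum>i=0..n. (x (i + 1) - x (i - 1) + y i - y (i + 1)) * f (x i)))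
    \<and> ((\<exists>i\<in>{1..n-1}. y i < x i \<and> x i < y (i + 1)) \<longrightarrow>
        (\<Sum>i=0..n. (y (i + 1) - y i) * f (x i))
          < (\<Sum>i=0..n+1. (y (i + 1) - y (i - 1) + x (i - 1) - x i) * f (y i))))"
proof -
  define z where "z = (\<lambda>i. x (i - 1))"
  \<comment> \<open>The lower bound is the second half of the interlacing hypothesis at
    \<open>i - 1\<close>, the upper bound its first half at \<open>i\<close>. The two uncovered
    cases are equalities: \<open>y 0 = x 0 = a\<close> for \<open>i = 1\<close> and
    \<open>x n = y (n + 1) = b\<close> for \<open>i = n + 1\<close>.\<close>
  have yz: "\<forall>i\<in>{1..n+1}. y (i - 1) \<le> z i \<and> z i \<le> y i"
  proof
    fix i assume i: "i \<in> {1..n+1}"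
    have "y (i - 1) \<le> x (i - 1)"
    proof (cases "i = 1")
      case False
      then have "i - 1 \<in> {1..n}"
        using i by auto
      then show ?thesis
        using assms(9) by blast
    qed (simp add: assms(3,6))
    moreover have "x (i - 1) \<le> y i"
    proof (cases "i = n + 1")
      case False
      then have "i \<in> {1..n}"
        using i by auto
      then show ?thesis
        using assms(9) by blast
    qed (simp add: assms(4,7))
    ultimately show "y (i - 1) \<le> z i \<and> z i \<le> y i"
      by (simp add: z_def)
  qed
  have n: "0 \<le> n" "0 \<le> n + 1"
    using assms(2) by auto
  have x_ends: "y 0 = x (-1)" "y (n + 1) = x (n + 1)"
    by (simp_all only: assms)
  have y_ends: "z 0 = y (-1)" "z (n + 1 + 1) = y (n + 1 + 1)"
    using assms(10-13) by (simp_all add: z_def add.commute)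
  have II_left: "(\<Sum>i=1..n+1. (y i - y (i - 1)) * f (z i)) = (\<Sum>i=0..n. (y (i + 1) - y i) * f (x i))"
    using sum_int_shift[of "\<lambda>i. (y i - y (i - 1)) * f (z i)" 1 0 n] by (simp add: z_def)
  have II_right: "(\<Sum>i=0..n+1. (y (i + 1) - y (i - 1) + z i - z (i + 1)) * f (y i))
    = (\<Sum>i=0..n+1. (y (i + 1) - y (i - 1) + x (i - 1) - x i) * f (y i))"
    by (simp add: z_def)
  \<comment> \<open>A witness \<open>i\<close> moves to \<open>i + 1\<close>, since
    \<open>z (i + 1) = x i\<close>.\<close>
  have II_strict: "\<exists>i\<in>{1..n+1}. y (i - 1) < z i \<and> z i < y i"
    if "\<exists>i\<in>{1..n-1}. y i < x i \<and> x i < y (i + 1)"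
  proof -
    from that obtain i where "i \<in> {1..n-1}" "y i < x i \<and> x i < y (i + 1)"
      by blast
    then show ?thesis
      by (intro bexI[of _ "i + 1"]) (auto simp: z_def)
  qed
  note I = convex_on_interlacing_sum_le[OF n(1) assms(9) x_ends, of f]
    strictly_convex_on_interlacing_sum_less[OF n(1) assms(9) x_ends, of f]
  note II = convex_on_interlacing_sum_le[OF n(2) yz y_ends, of f]
    strictly_convex_on_interlacing_sum_less[OF n(2) yz y_ends, of f]
  \<comment> \<open>The endpoint values turn both \<open>{x 0..x n}\<close> and
    \<open>{y 0..y (n + 1)}\<close> into \<open>{a..b}\<close>.\<close>
  show ?thesis
    using I II[unfolded II_left II_right] II_strict
    unfolding assms(3,4,6,7) by blast
qed

end
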